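(* Let $G$ be a simple connected graph on $n$ vertices. If $q_0$ is an eigenvalue of the signless Laplacian $Q(G)$ of multiplicity $s\geq 2$, then $n-2-q_0$ is an eigenvalue of the signless Laplacian $Q(\overline{G})$ of the complement $\overline{G}$ with multiplicity $t$, where $s-1\leq t\leq s+1$.
   Context: For a simple graph $H$, $Q(H)=D(H)+A(H)$ is its signless Laplacian matrix ($D(H)$ the diagonal degree matrix, $A(H)$ the adjacency matrix). $\overline{G}$ denotes the complement of $G$. *)

theory Defs
  imports "Graph_Theory.Graph_Theory" "Jordan_Normal_Form.Char_Poly"
begin

text \<open>
  A finite simple graph is a \<open>pair_graph\<close>: a finite, loop-free digraph without parallel
  arcs whose arc set is symmetric; the edge uv is the pair of arcs (u,v) and (v,u).
\<close>

definition graph_complement :: "'v pair_pre_digraph \<Rightarrow> 'v pair_pre_digraph" where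
  "graph_complement G = \<lparr> pverts = pverts G,
     parcs = {(u, v). u \<in> pverts G \<and> v \<in> pverts G \<and> u \<noteq> v \<and> (u, v) \<notin> parcs G} \<rparr>"

text \<open>
  Matrices are indexed by \<open>{0..<n}\<close>, so the matrices of a graph are taken with respect to an
  enumeration \<open>vs\<close> of its vertices (without repetition): index i stands for the vertex \<open>vs ! i\<close>.
\<close>

definition adjacency_matrix :: "'v pair_pre_digraph \<Rightarrow> 'v list \<Rightarrow> real mat" where
  "adjacency_matrix G vs = mat (length vs) (length vs)
     (\<lambda>(i, j). if (vs ! i, vs ! j) \<in> parcs G then 1 else 0)"

text \<open>By symmetry of the arc set, the out-degree is the number of neighbours.\<close>

definition degree_matrix :: "'v pair_pre_digraph \<Rightarrow> 'v list \<Rightarrow> real mat" where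
  "degree_matrix G vs = mat (length vs) (length vs)
     (\<lambda>(i, j). if i = j then real (out_degree (with_proj G) (vs ! i)) else 0)"

definition signless_laplacian :: "'v pair_pre_digraph \<Rightarrow> 'v list \<Rightarrow> real mat" where
  "signless_laplacian G vs = degree_matrix G vs + adjacency_matrix G vs"

text \<open>Multiplicity is algebraic multiplicity, i.e. as a root of the characteristic polynomial.\<close>

definition eigenvalue_with_multiplicity :: "real mat \<Rightarrow> real \<Rightarrow> nat \<Rightarrow> bool" where
  "eigenvalue_with_multiplicity A k m \<longleftrightarrow>
     eigenvalue A k \<and> Polynomial.order k (char_poly A) = m"

end

theory Submission
  imports Defs "Jordan_Normal_Form.Jordan_Normal_Form_Existence"
begin

text \<open>
  Since \<open>Q(G) + Q(G\<^sup>c) = (n - 2) I + J\<close> with \<open>J\<close> the all-ones matrix of rank one, it suffices that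
  for a real symmetric \<open>A\<close> and \<open>C = k I + u v\<^sup>T - A\<close> the multiplicity of \<open>q\<close> in \<open>A\<close> exceeds that of
  \<open>k - q\<close> in \<open>C\<close> by at most one; the two bounds follow by using this for \<open>G\<close> and for its complement.
  After diagonalizing \<open>A\<close>, the matrix \<open>C\<close> becomes a diagonal matrix plus a rank-one matrix, and among
  the \<open>m\<close> rows with diagonal entry \<open>k - q\<close> row operations produce \<open>m - 1\<close> left eigenvectors.
\<close>

section \<open>Left eigenvectors and rank-one updates of diagonal matrices\<close>

text \<open>Multiplying \<open>x I - A\<close> on the left by the constant matrix \<open>K\<close>
  changes its determinant only by the unit \<open>det K\<close>, while each row in \<open>T\<close>
  becomes \<open>x - r\<close> times a constant row and so contributes one factor.\<close>

lemma left_eigenrows_dvd_char_poly: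
  fixes A K :: "'a :: field mat"
  assumes A: "A \<in> carrier_mat n n" and K: "K \<in> carrier_mat n n" and detK: "det K \<noteq> 0"
    and T: "T \<subseteq> {0..<n}"
    and row: "\<And>i j. i \<in> T \<Longrightarrow> j < n \<Longrightarrow> (K * A) $$ (i, j) = r * K $$ (i, j)"
  shows "[:- r, 1:] ^ card T dvd char_poly A"
proof -
  interpret const_hom: comm_ring_hom "\<lambda>a :: 'a. [:a:]"
    by unfold_locales (auto simp: one_pCons)
  define M where "M = map_mat (\<lambda>a. [:a:]) K * char_poly_matrix A"
  have M: "M \<in> carrier_mat n n" using A K unfolding M_def by auto
  have entry: "M $$ (i, j) = [:- (K * A) $$ (i, j), K $$ (i, j):]" if "i < n" "j < n" for i j
  proof -
    have "M $$ (i, j) = (\<Sum>k = 0..<n. [:K $$ (i, k):] * ((if k = j then [:0, 1:] else 0) + [:- A $$ (k, j):]))"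
      using A K that unfolding M_def char_poly_matrix_def
      by (auto simp: scalar_prod_def intro!: sum.cong)
    also have "\<dots> = (\<Sum>k = 0..<n. if k = j then [:0, K $$ (i, j):] else 0)
        + (\<Sum>k = 0..<n. [:- (K $$ (i, k) * A $$ (k, j)):])"
      unfolding sum.distrib[symmetric] by (rule sum.cong) (auto simp: algebra_simps)
    also have "(\<Sum>k = 0..<n. [:- (K $$ (i, k) * A $$ (k, j)):]) = [:- (K * A) $$ (i, j):]"
    proof -
      have "(K * A) $$ (i, j) = (\<Sum>k = 0..<n. K $$ (i, k) * A $$ (k, j))"
        using A K that by (simp add: scalar_prod_def)
      then show ?thesis by (simp add: const_hom.hom_sum[symmetric] sum_negf)
    qed
    finally show ?thesis using that by simp
  qed
  have T_dvd: "[:- r, 1:] dvd M $$ (i, j)" if "i \<in> T" "j < n" for i j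
  proof -
    have "M $$ (i, j) = [:- r, 1:] * [:K $$ (i, j):]"
      using entry[of i j] row[OF that] that T by auto
    then show ?thesis by (rule dvdI)
  qed
  \<comment> \<open>Each term of the Leibniz expansion contains one entry from every row in
    \<open>T\<close>.\<close>
  have "[:- r, 1:] ^ card T dvd det M"
    unfolding det_def'[OF M]
  proof (intro dvd_sum dvd_mult)
    fix p assume "p \<in> {p. p permutes {0..<n}}"
    then have p: "p i < n" if "i < n" for i using that permutes_in_image[of p "{0..<n}" i] by auto
    have "[:- r, 1:] ^ card T = (\<Prod>i\<in>T. [:- r, 1:])" by simp
    also have "\<dots> dvd (\<Prod>i\<in>T. M $$ (i, p i))"
      using T by (intro prod_dvd_prod T_dvd p) auto
    also have "\<dots> dvd (\<Prod>i = 0..<n. M $$ (i, p i))"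
      using T by (intro prod_dvd_prod_subset) auto
    finally show "[:- r, 1:] ^ card T dvd (\<Prod>i = 0..<n. M $$ (i, p i))" .
  qed
  also have "det M = [:det K:] * char_poly A"
    unfolding M_def char_poly_def
    using A K by (subst det_mult[of _ n]) (auto simp: const_hom.hom_det)
  finally show ?thesis using detK by (simp add: dvd_smult_iff)
qed

lemma char_poly_diagonal_plus_rank_one:
  fixes M :: "'a :: field mat"
  assumes M: "M \<in> carrier_mat n n"
    and entry: "\<And>i j. i < n \<Longrightarrow> j < n \<Longrightarrow>
      M $$ (i, j) = (if i = j then d i else 0) + a i * b j"
  shows "[:- r, 1:] ^ (card {i. i < n \<and> d i = r} - 1) dvd char_poly M"
proof (cases "{i. i < n \<and> d i = r} = {}")
  \<comment> \<open>The exponent is the truncated difference \<open>0 - 1 = 0\<close>.\<close>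
  case True
  show ?thesis unfolding True by simp
next
  case False
  define S where "S = {i. i < n \<and> d i = r}"
  \<comment> \<open>The pivot row \<open>k\<close> clears the rank-one part of the other rows of \<open>S\<close>. Taking it least makes the
    elimination matrix lower triangular; if \<open>a\<close> vanishes on \<open>S\<close>, then \<open>a i / a k = 0\<close> is harmless.\<close>
  have "\<exists>k\<in>S. \<forall>i\<in>S. i < k \<or> a k = 0 \<longrightarrow> a i = 0"
  proof (cases "\<exists>i\<in>S. a i \<noteq> 0")
    case True
    define k where "k = (LEAST i. i \<in> S \<and> a i \<noteq> 0)"
    have "k \<in> S \<and> a k \<noteq> 0" unfolding k_def by (rule LeastI_ex) (use True in auto)
    moreover have "a i = 0" if "i \<in> S" "i < k" for i
      using not_less_Least[of i "\<lambda>i. i \<in> S \<and> a i \<noteq> 0"] that unfolding k_def by auto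
    ultimately show ?thesis by blast
  next
    case 0: False
    then show ?thesis using False unfolding S_def by auto
  qed
  then obtain k where k: "k \<in> S" and below: "\<And>i. i \<in> S \<Longrightarrow> i < k \<Longrightarrow> a i = 0"
    and zero: "\<And>i. i \<in> S \<Longrightarrow> a k = 0 \<Longrightarrow> a i = 0" by blast
  have kn: "k < n" "d k = r" using k unfolding S_def by auto
  define K where "K = mat n n (\<lambda>(i, j). if i = j then 1 else if j = k \<and> i \<in> S then - (a i / a k) else 0)"
  have K: "K \<in> carrier_mat n n" unfolding K_def by simp
  have "det K = prod_list (diag_mat K)"
    by (rule det_lower_triangular[OF _ K]) (auto simp: K_def below)
  also have "\<dots> = 1" unfolding diag_mat_def K_def by (auto intro!: prod_list_neutral)
  finally have detK: "det K \<noteq> 0" by simp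
  have row: "(K * M) $$ (i, j) = r * K $$ (i, j)" if i: "i \<in> S - {k}" and j: "j < n" for i j
  proof -
    have i': "i < n" "d i = r" "i \<noteq> k" "i \<in> S" using i unfolding S_def by auto
    have "(K * M) $$ (i, j) = (\<Sum>l = 0..<n. K $$ (i, l) * M $$ (l, j))"
      using K M i' j by (simp add: scalar_prod_def)
    also have "\<dots> = (\<Sum>l = 0..<n. (if l = i then M $$ (i, j) else 0)
        + (if l = k then - (a i / a k) * M $$ (k, j) else 0))"
      using i' by (intro sum.cong) (auto simp: K_def)
    also have "\<dots> = M $$ (i, j) - (a i / a k) * M $$ (k, j)"
      using i' kn by (simp add: sum.distrib)
    \<comment> \<open>Rows \<open>i\<close> and \<open>k\<close> share the diagonal value
      \<open>r\<close>, so the \<open>b j\<close> terms cancel and \<open>r\<close> factors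
      out.\<close>
    also have "\<dots> = r * K $$ (i, j)"
      using i' kn j zero[of i] by (cases "a k = 0") (auto simp: entry K_def field_simps)
    finally show ?thesis .
  qed
  have "[:- r, 1:] ^ card (S - {k}) dvd char_poly M"
    by (rule left_eigenrows_dvd_char_poly[OF M K detK _ row]) (auto simp: S_def)
  then show ?thesis using k unfolding S_def by simp
qed

section \<open>Diagonalizability of Hermitian matrices\<close>

text \<open>Such an entry lies inside a single Jordan block, whose diagonal is constant. The equal
  diagonal entries later put both vectors of a chain over the same eigenvalue.\<close>

lemma jordan_matrix_off_diagonal:
  assumes "i < sum_list (map fst n_as)" "j < sum_list (map fst n_as)" "i \<noteq> j"
    and "jordan_matrix n_as $$ (i, j) \<noteq> 0"
  shows "j = Suc i \<and> jordan_matrix n_as $$ (i, i) = jordan_matrix n_as $$ (j, j)"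
  using assms
proof (induct n_as arbitrary: i j)
  case (Cons na n_as)
  obtain m a where na: "na = (m, a)" by force
  have mem: "i < m + sum_list (map fst n_as)" "j < m + sum_list (map fst n_as)"
    using Cons.prems na by auto
  show ?case
  proof (cases "i < m \<or> j < m")
    case True
    then show ?thesis
      using mem Cons.prems(3,4) unfolding na jordan_matrix_Cons by (auto split: if_splits)
  next
    case False
    then have "jordan_matrix n_as $$ (i - m, j - m) \<noteq> 0"
      using mem Cons.prems(4) unfolding na jordan_matrix_Cons by auto
    then have "j - m = Suc (i - m) \<and>
        jordan_matrix n_as $$ (i - m, i - m) = jordan_matrix n_as $$ (j - m, j - m)"
      using mem False Cons.prems(3) by (intro Cons.hyps) auto
    then show ?thesis
      using mem False unfolding na jordan_matrix_Cons by auto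
  qed
qed simp

lemma self_adjoint_cscalar_prod:
  fixes A :: "complex mat"
  assumes A: "A \<in> carrier_mat n n"
    and herm: "\<And>i j. i < n \<Longrightarrow> j < n \<Longrightarrow> A $$ (i, j) = cnj (A $$ (j, i))"
    and x: "x \<in> carrier_vec n" and y: "y \<in> carrier_vec n"
  shows "(A *\<^sub>v x) \<bullet>c y = x \<bullet>c (A *\<^sub>v y)"
proof -
  have "(A *\<^sub>v x) \<bullet>c y = (\<Sum>i = 0..<n. \<Sum>j = 0..<n. A $$ (i, j) * x $ j * cnj (y $ i))"
    using A x y by (simp add: scalar_prod_def sum_distrib_right)
  also have "\<dots> = (\<Sum>j = 0..<n. \<Sum>i = 0..<n. A $$ (i, j) * x $ j * cnj (y $ i))"
    by (rule sum.swap)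
  also have "\<dots> = (\<Sum>j = 0..<n. \<Sum>i = 0..<n. x $ j * (cnj (A $$ (j, i)) * cnj (y $ i)))"
  proof (intro sum.cong refl, goal_cases)
    case (1 j i)
    then show ?case using herm[of i j] by (simp add: ac_simps)
  qed
  also have "\<dots> = x \<bullet>c (A *\<^sub>v y)"
    using A x y by (simp add: scalar_prod_def sum_distrib_left)
  finally show ?thesis .
qed

text \<open>The columns of \<open>P\<close> form a Jordan basis. Going through them from left to
  right, each superdiagonal entry of \<open>J\<close> vanishes because self-adjointness rules out
  Jordan chains of length two.\<close>

lemma hermitian_diagonalizable:
  fixes A :: "complex mat"
  assumes A: "A \<in> carrier_mat n n"
    and herm: "\<And>i j. i < n \<Longrightarrow> j < n \<Longrightarrow> A $$ (i, j) = cnj (A $$ (j, i))"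
  obtains D P Q where "similar_mat_wit A D P Q" and "diagonal_mat D"
proof -
  obtain n_as where jnf: "jordan_nf A n_as"
    using char_poly_factorized[OF A] jordan_nf_exists[OF A] by blast
  define J where "J = jordan_matrix n_as"
  obtain P Q where wit: "similar_mat_wit A J P Q"
    using jnf unfolding jordan_nf_def similar_mat_def J_def by auto
  note wD = similar_mat_witD2[OF A wit]
  have J: "J \<in> carrier_mat n n" and P: "P \<in> carrier_mat n n" and Q: "Q \<in> carrier_mat n n"
    and PQ: "P * Q = 1\<^sub>m n" and QP: "Q * P = 1\<^sub>m n" and AJ: "A = P * J * Q"
    using wD by auto
  have size: "sum_list (map fst n_as) = n" using J unfolding J_def by auto
  have bidiag: "j = Suc i" "J $$ (i, i) = J $$ (j, j)"
    if "i < n" "j < n" "i \<noteq> j" "J $$ (i, j) \<noteq> 0" for i j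
    using jordan_matrix_off_diagonal[of i n_as j] that size unfolding J_def by auto
  have "A * P = P * J * (Q * P)" unfolding AJ using P Q J by (intro assoc_mult_mat) auto
  then have AP: "A * P = P * J" using P J QP by simp
  \<comment> \<open>A column with no entry above the diagonal starts a Jordan chain, so it is an
    eigenvector.\<close>
  have A_col: "A *\<^sub>v col P j = J $$ (j, j) \<cdot>\<^sub>v col P j" if "j < n" "j = 0 \<or> J $$ (j - 1, j) = 0" for j
  proof (rule eq_vecI)
    fix i assume "i < dim_vec (J $$ (j, j) \<cdot>\<^sub>v col P j)"
    then have i: "i < n" using P by simp
    have "(A *\<^sub>v col P j) $ i = (A * P) $$ (i, j)" using A P i that by simp
    also have "\<dots> = (\<Sum>k = 0..<n. P $$ (i, k) * J $$ (k, j))"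
      unfolding AP using P J i that by (simp add: scalar_prod_def)
    also have "\<dots> = (\<Sum>k = 0..<n. if k = j then P $$ (i, j) * J $$ (j, j) else 0)"
      using bidiag[of _ j] that by (intro sum.cong) fastforce+
    finally show "(A *\<^sub>v col P j) $ i = (J $$ (j, j) \<cdot>\<^sub>v col P j) $ i"
      using that i P by simp
  qed (use A P in auto)
  have A_col_Suc: "A *\<^sub>v col P (Suc j) =
      J $$ (Suc j, Suc j) \<cdot>\<^sub>v col P (Suc j) + J $$ (j, Suc j) \<cdot>\<^sub>v col P j" if "Suc j < n" for j
  proof (rule eq_vecI)
    fix i assume "i < dim_vec (J $$ (Suc j, Suc j) \<cdot>\<^sub>v col P (Suc j) + J $$ (j, Suc j) \<cdot>\<^sub>v col P j)"
    then have i: "i < n" using P by simp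
    have "(A *\<^sub>v col P (Suc j)) $ i = (A * P) $$ (i, Suc j)" using A P i that by simp
    also have "\<dots> = (\<Sum>k = 0..<n. P $$ (i, k) * J $$ (k, Suc j))"
      unfolding AP using P J i that by (simp add: scalar_prod_def)
    also have "\<dots> = (\<Sum>k = 0..<n. (if k = Suc j then P $$ (i, Suc j) * J $$ (Suc j, Suc j) else 0)
        + (if k = j then P $$ (i, j) * J $$ (j, Suc j) else 0))"
      using bidiag[of _ "Suc j"] that by (intro sum.cong) fastforce+
    finally show "(A *\<^sub>v col P (Suc j)) $ i =
        (J $$ (Suc j, Suc j) \<cdot>\<^sub>v col P (Suc j) + J $$ (j, Suc j) \<cdot>\<^sub>v col P j) $ i"
      using that i P by (simp add: sum.distrib)
  qed (use A P in auto)
  have col_nz: "col P j \<noteq> 0\<^sub>v n" if "j < n" for j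
  proof
    assume "col P j = 0\<^sub>v n"
    moreover have "(Q * P) $$ (j, j) = row Q j \<bullet> col P j" using P Q that by simp
    ultimately show False using QP Q that by (simp add: scalar_prod_def)
  qed
  have col: "col P j \<in> carrier_vec n" for j using P by (simp add: col_carrier_vec carrier_vecI)
  note self_adj = self_adjoint_cscalar_prod[OF A herm col col]
  \<comment> \<open>Otherwise \<open>y\<close> would be a generalized eigenvector of rank two above the eigenvector \<open>x\<close>, and
    comparing \<open>\<langle>A y, x\<rangle>\<close> with \<open>\<langle>y, A x\<rangle>\<close> gives \<open>c \<langle>x, x\<rangle> = 0\<close>.\<close>
  have step: "J $$ (j, Suc j) = 0" if j: "Suc j < n" and prev: "j = 0 \<or> J $$ (j - 1, j) = 0" for j
  proof (rule ccontr)
    define x y where "x = col P j" and "y = col P (Suc j)"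
    define a c where "a = J $$ (j, j)" and "c = J $$ (j, Suc j)"
    have x: "x \<in> carrier_vec n" and y: "y \<in> carrier_vec n" unfolding x_def y_def by (rule col)+
    assume "J $$ (j, Suc j) \<noteq> 0"
    then have c: "c \<noteq> 0" and Ay: "A *\<^sub>v y = a \<cdot>\<^sub>v y + c \<cdot>\<^sub>v x"
      using A_col_Suc[OF j] bidiag(2)[of j "Suc j"] j unfolding a_def c_def x_def y_def by auto
    have Ax: "A *\<^sub>v x = a \<cdot>\<^sub>v x" using A_col[OF _ prev] j unfolding a_def x_def by simp
    have xx: "x \<bullet>c x \<noteq> 0" using conjugate_square_eq_0_vec[OF x] col_nz[of j] j unfolding x_def by simp
    \<comment> \<open>The eigenvalue must first be shown real, so that the multiples of
      \<open>y \<bullet>c x\<close> cancel below.\<close>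
    have "a * (x \<bullet>c x) = cnj a * (x \<bullet>c x)"
      using self_adj[of j j] x unfolding x_def[symmetric] Ax by (simp add: conjugate_smult_vec)
    then have a: "cnj a = a" using xx by simp
    have "a * (y \<bullet>c x) + c * (x \<bullet>c x) = cnj a * (y \<bullet>c x)"
      using self_adj[of "Suc j" j] x y unfolding x_def[symmetric] y_def[symmetric] Ax Ay
      by (simp add: conjugate_smult_vec add_scalar_prod_distrib[of _ n])
    then show False using a c xx by simp
  qed
  have super_zero: "J $$ (j, Suc j) = 0" if "Suc j < n" for j
    using that
  proof (induct j)
    case 0
    then show ?case using step[of 0] by blast
  next
    case (Suc j)
    then show ?case using step[of "Suc j"] by simp
  qed
  have "J $$ (i, j) = 0" if "i < n" "j < n" "i \<noteq> j" for i j
    using bidiag(1)[OF that] super_zero[of i] that by blast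
  then have "diagonal_mat J"
    unfolding diagonal_mat_def using J by auto
  with wit show thesis by (rule that)
qed


section \<open>Multiplicities under reflection with a rank-one update\<close>

lemma order_char_poly_diagonal:
  fixes D :: "'a :: field mat"
  assumes D: "D \<in> carrier_mat n n" and diag: "diagonal_mat D"
  shows "Polynomial.order q (char_poly D) = card {i. i < n \<and> D $$ (i, i) = q}"
proof -
  have "upper_triangular D" using D diag unfolding diagonal_mat_def by auto
  then have "char_poly D = (\<Prod>a\<leftarrow>diag_mat D. [:- a, 1:])"
    by (rule char_poly_upper_triangular[OF D])
  also have "\<dots> = (\<Prod>i = 0..<n. [:- D $$ (i, i), 1:])"
    using D by (simp add: diag_mat_def o_def prod.distinct_set_conv_list[symmetric] flip: atLeastLessThan_upt)
  finally have cp: "char_poly D = (\<Prod>i = 0..<n. [:- D $$ (i, i), 1:])" .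
  have "Polynomial.order q (\<Prod>i\<in>I. [:- D $$ (i, i), 1:]) = card {i \<in> I. D $$ (i, i) = q}"
    if "finite I" for I
    using that
  proof (induct I)
    case (insert i I)
    have "[:- D $$ (i, i), 1:] * (\<Prod>i\<in>I. [:- D $$ (i, i), 1:]) \<noteq> 0"
      using insert(1) by (simp only: mult_eq_0_iff prod_zero_iff) auto
    moreover have "{k \<in> insert i I. D $$ (k, k) = q} =
        (if D $$ (i, i) = q then insert i {k \<in> I. D $$ (k, k) = q} else {k \<in> I. D $$ (k, k) = q})"
      by auto
    ultimately show ?case
      using insert by (simp add: order_mult order_linear' del: mult_pCons_left)
  qed simp
  from this[of "{0..<n}"] show ?thesis unfolding cp by simp
qed

lemma order_char_poly_rank_one_reflection:
  fixes A C :: "complex mat"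
  assumes A: "A \<in> carrier_mat n n" and C: "C \<in> carrier_mat n n"
    and herm: "\<And>i j. i < n \<Longrightarrow> j < n \<Longrightarrow> A $$ (i, j) = cnj (A $$ (j, i))"
    and sum: "\<And>i j. i < n \<Longrightarrow> j < n \<Longrightarrow>
      A $$ (i, j) + C $$ (i, j) = (if i = j then k else 0) + u i * v j"
  shows "Polynomial.order q (char_poly A) \<le> Polynomial.order (k - q) (char_poly C) + 1"
proof -
  obtain D P Q where wit: "similar_mat_wit A D P Q" and diag: "diagonal_mat D"
    using hermitian_diagonalizable[OF A herm] by blast
  have D: "D \<in> carrier_mat n n" and P: "P \<in> carrier_mat n n" and Q: "Q \<in> carrier_mat n n"
    and PQ: "P * Q = 1\<^sub>m n" and QP: "Q * P = 1\<^sub>m n" and AD: "A = P * D * Q"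
    using similar_mat_witD2[OF A wit] by auto
  \<comment> \<open>Writing the update as a column times a row makes it visible that conjugation
    keeps this form: it becomes \<open>(Q * X) * (Y * P)\<close>.\<close>
  define X where "X = mat n 1 (\<lambda>(i, _). u i)"
  define Y where "Y = mat 1 n (\<lambda>(_, j). v j)"
  have X: "X \<in> carrier_mat n 1" and Y: "Y \<in> carrier_mat 1 n" unfolding X_def Y_def by auto
  define M where "M = Q * C * P"
  have M: "M \<in> carrier_mat n n" unfolding M_def using Q C P by simp
  have QAP: "Q * A * P = D"
  proof -
    have "Q * A = (Q * P) * (D * Q)"
      unfolding AD using P Q D assoc_mult_mat[OF Q P, of "D * Q" n] by simp
    also have "\<dots> = D * Q" using QP D Q by simp
    finally have "Q * A * P = D * Q * P" by simp
    also have "\<dots> = D" using assoc_mult_mat[OF D Q P] QP D by simp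
    finally show ?thesis .
  qed
  have "C = k \<cdot>\<^sub>m 1\<^sub>m n + X * Y - A"
  proof (rule eq_matI)
    fix i j assume "i < dim_row (k \<cdot>\<^sub>m 1\<^sub>m n + X * Y - A)" "j < dim_col (k \<cdot>\<^sub>m 1\<^sub>m n + X * Y - A)"
    then have ij: "i < n" "j < n" using A by auto
    then show "C $$ (i, j) = (k \<cdot>\<^sub>m 1\<^sub>m n + X * Y - A) $$ (i, j)"
      using sum[OF ij] A X Y by (auto simp: X_def Y_def scalar_prod_def algebra_simps)
  qed (use A C in auto)
  then have "M = Q * (k \<cdot>\<^sub>m 1\<^sub>m n + X * Y - A) * P" unfolding M_def by simp
  also have "\<dots> = Q * (k \<cdot>\<^sub>m 1\<^sub>m n) * P + Q * (X * Y) * P - Q * A * P"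
    using P Q A X Y
    by (simp add: mult_minus_distrib_mat[of _ n n _ n] minus_mult_distrib_mat[of _ n n _ _ n]
        mult_add_distrib_mat[of _ n n _ n] add_mult_distrib_mat[of _ n n _ _ n])
  also have "Q * (k \<cdot>\<^sub>m 1\<^sub>m n) * P = k \<cdot>\<^sub>m (Q * P)"
  proof -
    have "Q * (k \<cdot>\<^sub>m 1\<^sub>m n) = k \<cdot>\<^sub>m Q" using Q by (simp add: mult_smult_distrib[OF Q one_carrier_mat])
    then show ?thesis using mult_smult_assoc_mat[OF Q P] by simp
  qed
  also have "Q * (X * Y) * P = (Q * X) * (Y * P)"
  proof -
    have "Q * (X * Y) * P = Q * X * Y * P" using assoc_mult_mat[OF Q X Y] by simp
    also have "\<dots> = (Q * X) * (Y * P)" using Q X Y P by (intro assoc_mult_mat) auto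
    finally show ?thesis .
  qed
  finally have M_eq: "M = k \<cdot>\<^sub>m 1\<^sub>m n + (Q * X) * (Y * P) - D" unfolding QP QAP .
  have entry: "M $$ (i, j) = (if i = j then k - D $$ (i, i) else 0) + (Q * X) $$ (i, 0) * (Y * P) $$ (0, j)"
    if "i < n" "j < n" for i j
  proof -
    have "((Q * X) * (Y * P)) $$ (i, j) = (Q * X) $$ (i, 0) * (Y * P) $$ (0, j)"
      using that Q X Y P by (simp add: scalar_prod_def[of "vec _ _"])
    moreover have "D $$ (i, j) = 0" if "i \<noteq> j" using diag that \<open>i < n\<close> \<open>j < n\<close> D unfolding diagonal_mat_def by auto
    ultimately show ?thesis unfolding M_eq using that Q X Y P D by auto
  qed
  \<comment> \<open>The diagonal part takes the value \<open>k - q\<close> exactly where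
    \<open>D\<close> has the entry \<open>q\<close>, so the count is the multiplicity of
    \<open>q\<close> in \<open>A\<close>.\<close>
  have "[:- (k - q), 1:] ^ (card {i. i < n \<and> k - D $$ (i, i) = k - q} - 1) dvd char_poly M"
    by (rule char_poly_diagonal_plus_rank_one[OF M entry])
  also have "char_poly M = char_poly C"
  proof (rule char_poly_similar)
    have "similar_mat_wit M C Q P"
      using M C P Q PQ QP unfolding similar_mat_wit_def Let_def M_def by auto
    then show "similar_mat M C" unfolding similar_mat_def by blast
  qed
  finally have "card {i. i < n \<and> D $$ (i, i) = q} - 1 \<le> Polynomial.order (k - q) (char_poly C)"
    using degree_monic_char_poly[OF C] by (intro order_max) auto
  moreover have "char_poly A = char_poly D"
    using wit by (intro char_poly_similar) (auto simp: similar_mat_def)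
  ultimately show ?thesis using order_char_poly_diagonal[OF D diag, of q] by simp
qed

text \<open>An injective field homomorphism commutes with forming characteristic polynomials and
  preserves orders of roots. This brings the bound back from the complex numbers, where Jordan forms
  always exist.\<close>

lemma order_char_poly_of_real:
  fixes A :: "real mat"
  assumes A: "A \<in> carrier_mat n n"
  shows "Polynomial.order (complex_of_real q) (char_poly (map_mat complex_of_real A)) =
    Polynomial.order q (char_poly A)"
proof -
  interpret map_poly_inj_idom_divide_hom complex_of_real
    by unfold_locales (auto simp: of_real_divide)
  show ?thesis unfolding of_real_hom.char_poly_hom[OF A] by (rule order_hom)
qed

lemma order_char_poly_real_rank_one_reflection:
  fixes A C :: "real mat"
  assumes A: "A \<in> carrier_mat n n" and C: "C \<in> carrier_mat n n"
    and sym: "\<And>i j. i < n \<Longrightarrow> j < n \<Longrightarrow> A $$ (i, j) = A $$ (j, i)"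
    and sum: "\<And>i j. i < n \<Longrightarrow> j < n \<Longrightarrow>
      A $$ (i, j) + C $$ (i, j) = (if i = j then k else 0) + u i * v j"
  shows "Polynomial.order q (char_poly A) \<le> Polynomial.order (k - q) (char_poly C) + 1"
proof -
  let ?c = "map_mat complex_of_real"
  have "Polynomial.order (of_real q) (char_poly (?c A)) \<le>
      Polynomial.order (of_real k - of_real q) (char_poly (?c C)) + 1"
  proof (rule order_char_poly_rank_one_reflection)
    fix i j assume ij: "i < n" "j < n"
    show "?c A $$ (i, j) = cnj (?c A $$ (j, i))" using ij A sym[OF ij] by simp
    show "?c A $$ (i, j) + ?c C $$ (i, j) =
        (if i = j then of_real k else 0) + of_real (u i) * of_real (v j)"
      using ij A C arg_cong[OF sum[OF ij], of complex_of_real] by (auto split: if_splits)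
  qed (use A C in auto)
  then show ?thesis
    using order_char_poly_of_real[OF A, of q] order_char_poly_of_real[OF C, of "k - q"] by simp
qed

section \<open>Signless Laplacians of a graph and its complement\<close>

lemma signless_laplacian_carrier: "signless_laplacian G vs \<in> carrier_mat (length vs) (length vs)"
  unfolding signless_laplacian_def degree_matrix_def adjacency_matrix_def by simp

lemma signless_laplacian_index:
  assumes "i < length vs" "j < length vs"
  shows "signless_laplacian G vs $$ (i, j) =
    (if i = j then real (out_degree (with_proj G) (vs ! i)) else 0)
      + (if (vs ! i, vs ! j) \<in> parcs G then 1 else 0)"
  using assms unfolding signless_laplacian_def degree_matrix_def adjacency_matrix_def by auto

text \<open>Every vertex is \<open>v\<close>, a neighbour of \<open>v\<close> in \<open>G\<close>,
  or a neighbour of \<open>v\<close> in the complement; the \<open>1\<close> counts \<open>v\<close>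
  itself.\<close>

lemma out_degree_graph_complement:
  assumes "pair_graph G" and v: "v \<in> pverts G"
  shows "out_degree (with_proj G) v + out_degree (with_proj (graph_complement G)) v + 1
    = card (pverts G)"
proof -
  interpret pair_graph G by fact
  let ?N = "{w. (v, w) \<in> parcs G}" and ?N' = "{w \<in> pverts G. w \<noteq> v \<and> (v, w) \<notin> parcs G}"
  have "out_arcs (with_proj G) v = Pair v ` ?N"
    "out_arcs (with_proj (graph_complement G)) v = Pair v ` ?N'"
    using v by (auto simp: out_arcs_def graph_complement_def)
  then have deg: "out_degree (with_proj G) v = card ?N"
    "out_degree (with_proj (graph_complement G)) v = card ?N'"
    unfolding out_degree_def by (simp_all add: card_image inj_on_def)
  have N: "?N \<subseteq> pverts G - {v}" using in_arcsD2 pair_no_loops by force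
  have "pverts G = insert v (?N \<union> ?N')" using N v by auto
  then have "card (pverts G) = card (insert v (?N \<union> ?N'))" by simp
  also have "\<dots> = Suc (card ?N + card ?N')"
    using N finite_subset[OF N] pair_finite_verts
    by (subst card_insert_disjoint) (auto intro!: card_Un_disjoint)
  finally show ?thesis using deg by simp
qed

theorem theorem2p7:
  fixes G :: "'v pair_pre_digraph" and vs :: "'v list" and n s :: nat and q0 :: real
  assumes "pair_graph G" and "Digraph_Component.connected (with_proj G)"
    and "card (pverts G) = n"
    and "distinct vs" and "set vs = pverts G"
    and "eigenvalue_with_multiplicity (signless_laplacian G vs) q0 s"
    and "s \<ge> 2"
  shows "\<exists>t. eigenvalue_with_multiplicity (signless_laplacian (graph_complement G) vs)
               (real n - 2 - q0) t \<and> s - 1 \<le> t \<and> t \<le> s + 1"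
proof -
  interpret pair_graph G by fact
  define A where "A = signless_laplacian G vs"
  define C where "C = signless_laplacian (graph_complement G) vs"
  define t where "t = Polynomial.order (real n - 2 - q0) (char_poly C)"
  have len: "length vs = n" using assms(3-5) distinct_card by fastforce
  have A: "A \<in> carrier_mat n n" and C: "C \<in> carrier_mat n n"
    unfolding A_def C_def using signless_laplacian_carrier len by metis+
  have arcs_sym: "(u, v) \<in> parcs G \<longleftrightarrow> (v, u) \<in> parcs G" for u v
    using arcs_symmetric by blast
  have symA: "A $$ (i, j) = A $$ (j, i)" if "i < n" "j < n" for i j
    using that len arcs_sym[of "vs ! i" "vs ! j"] by (simp add: A_def signless_laplacian_index)
  \<comment> \<open>On the diagonal the two degrees add up to \<open>n - 1 = (n - 2) + 1\<close>;
    off the diagonal exactly one of the two graphs has the edge. The product \<open>1 * 1\<close>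
    presents the all-ones matrix as \<open>u i * v j\<close>.\<close>
  have sum: "A $$ (i, j) + C $$ (i, j) = (if i = j then real n - 2 else 0) + 1 * 1"
    if ij: "i < n" "j < n" for i j
  proof -
    have mem: "vs ! i \<in> pverts G" "vs ! j \<in> pverts G" using ij len assms(5) nth_mem by blast+
    have loop: "(w, w) \<notin> parcs G" for w using pair_no_loops[of "(w, w)"] by auto
    have ne: "vs ! i = vs ! j \<longleftrightarrow> i = j" using nth_eq_iff_index_eq[OF assms(4)] ij len by simp
    have "real (out_degree (with_proj G) (vs ! i) + out_degree (with_proj (graph_complement G)) (vs ! i) + 1)
        = real n"
      using out_degree_graph_complement[OF assms(1) mem(1)] assms(3) by simp
    then show ?thesis
      using ij len mem ne loop
      by (auto simp: A_def C_def signless_laplacian_index graph_complement_def)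
  qed
  have symC: "C $$ (i, j) = C $$ (j, i)" if "i < n" "j < n" for i j
    using sum[OF that] sum[OF that(2,1)] symA[OF that] by (auto split: if_splits)
  have s: "Polynomial.order q0 (char_poly A) = s"
    using assms(6) unfolding eigenvalue_with_multiplicity_def A_def by simp
  have "s \<le> t + 1"
    using order_char_poly_real_rank_one_reflection[OF A C symA sum, of q0] unfolding s t_def .
  \<comment> \<open>The relation is symmetric in \<open>A\<close> and \<open>C\<close>, and
    reflecting \<open>n - 2 - q0\<close> gives back \<open>q0\<close>.\<close>
  moreover have "t \<le> s + 1"
  proof -
    have "C $$ (i, j) + A $$ (i, j) = (if i = j then real n - 2 else 0) + 1 * 1"
      if "i < n" "j < n" for i j
      using sum[OF that] by simp
    from order_char_poly_real_rank_one_reflection[OF C A symC this, of "real n - 2 - q0"]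
    show ?thesis using s unfolding t_def by simp
  qed
  moreover have "eigenvalue C (real n - 2 - q0)"
  proof -
    \<comment> \<open>As an order, \<open>t\<close> could be 0 at a non-root;
      \<open>s \<ge> 2\<close> forces it to be positive, so the reflected value is an
      eigenvalue.\<close>
    have "t \<noteq> 0" using \<open>s \<le> t + 1\<close> assms(7) by simp
    then show ?thesis
      unfolding eigenvalue_root_char_poly[OF C] t_def by (metis order_0I)
  qed
  ultimately show ?thesis
    unfolding eigenvalue_with_multiplicity_def C_def[symmetric] t_def[symmetric] by auto
qed

end
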